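(* Let $T$ be a triangle in a Minkowski plane $(\mathbb{R}^2,\|\cdot\|)$, with a circumball $B$ and circumcircle $S=\partial B$ centered at $M$. Let $F$ be an arbitrary side of $T$, opposite to the vertex $A$, and let $E$ be the medial line, i.e. the line bisecting every segment between $A$ and a point of $F$. Suppose that $M$ lies in $\mathrm{cone}((\mathrm{aff}(F)\cap B)\setminus F,\,A):=\{A+\lambda(X-A) : X\in (\mathrm{aff}(F)\cap B)\setminus F,\ \lambda\ge 0\}$. Then $M$ lies in $E$.
   Context: A Minkowski plane is $\mathbb{R}^2$ equipped with an arbitrary norm $\|\cdot\|$. For $r>0$, $B(X,r)=\{Y:\|Y-X\|\le r\}$ is the Minkowskian ball and $S(X,r)=\partial B(X,r)$ the Minkowskian circle with center $X$ and radius $r$. A circumcircle of a triangle is a Minkowskian circle containing all its vertices; the corresponding ball is a circumball and its center a circumcenter. The side $F$ is the closed segment joining the two vertices other than $A$, and $E=\tfrac12\left(A+\mathrm{aff}(F)\right)$. *)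

theory Defs
  imports "HOL-Analysis.Analysis"
begin

text \<open>
  The norm of a Minkowski plane is an arbitrary function \<open>N\<close> on \<open>real^2\<close> satisfying the norm
  axioms. The type-class constant \<open>norm\<close> is not used for it, since on \<open>real^2\<close> that constant is
  the Euclidean norm.
\<close>

definition is_norm :: "(real^2 \<Rightarrow> real) \<Rightarrow> bool" where
  "is_norm N \<longleftrightarrow>
     (\<forall>x. N x \<ge> 0) \<and>
     (\<forall>x. N x = 0 \<longleftrightarrow> x = 0) \<and>
     (\<forall>c x. N (c *\<^sub>R x) = \<bar>c\<bar> * N x) \<and>
     (\<forall>x y. N (x + y) \<le> N x + N y)"

definition mball :: "(real^2 \<Rightarrow> real) \<Rightarrow> real^2 \<Rightarrow> real \<Rightarrow> (real^2) set" where
  "mball N X r = {Y. N (Y - X) \<le> r}"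

text \<open>
  The boundary is taken in the standard topology of \<open>real^2\<close>, which is also the topology
  induced by any norm \<open>N\<close>.
\<close>

definition mcircle :: "(real^2 \<Rightarrow> real) \<Rightarrow> real^2 \<Rightarrow> real \<Rightarrow> (real^2) set" where
  "mcircle N X r = frontier (mball N X r)"

definition is_circumcircle ::
  "(real^2 \<Rightarrow> real) \<Rightarrow> real^2 \<Rightarrow> real^2 \<Rightarrow> real^2 \<Rightarrow> real^2 \<Rightarrow> real \<Rightarrow> bool" where
  "is_circumcircle N A P Q M r \<longleftrightarrow> r > 0 \<and> {A, P, Q} \<subseteq> mcircle N M r"

text \<open>
  The cone generated by \<open>K\<close> with apex \<open>A\<close>; it is empty if \<open>K\<close> is. The library predicate
  \<open>cone\<close> only concerns cones with apex \<open>0\<close>.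
\<close>

definition cone_from :: "(real^2) set \<Rightarrow> real^2 \<Rightarrow> (real^2) set" where
  "cone_from K A = {A + l *\<^sub>R (X - A) | l X. X \<in> K \<and> l \<ge> 0}"

definition medial_line :: "real^2 \<Rightarrow> (real^2) set \<Rightarrow> (real^2) set" where
  "medial_line A F = (\<lambda>X. (1/2) *\<^sub>R (A + X)) ` (affine hull F)"

end

theory Submission imports Defs begin

text \<open>
  Let \<open>M = A + l (X - A)\<close> with \<open>X\<close> on the line of \<open>F\<close>, in \<open>B\<close> but outside \<open>F\<close>. One endpoint of
  \<open>F\<close> lies strictly between \<open>X\<close> and the other endpoint, so convexity of the distance to \<open>M\<close>
  forces \<open>X\<close> to have distance \<open>r\<close> from \<open>M\<close>. Hence \<open>A\<close> and \<open>X\<close> are equidistant from the point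
  \<open>M\<close> of their line, so \<open>\<bar>l\<bar> = \<bar>1 - l\<bar>\<close> and \<open>M\<close> is the midpoint of \<open>A\<close> and \<open>X\<close>.
\<close>

text \<open>The norm axioms make \<open>N\<close> convex, and a finite convex function on a
  finite-dimensional space is continuous.\<close>

lemma is_norm_continuous_on:
  assumes "is_norm N"
  shows "continuous_on UNIV N"
proof (rule convex_on_continuous)
  show "convex_on UNIV N"
  proof (rule convex_onI)
    fix t :: real and x y :: "real^2"
    assume "0 < t" "t < 1"
    have "N ((1 - t) *\<^sub>R x + t *\<^sub>R y) \<le> N ((1 - t) *\<^sub>R x) + N (t *\<^sub>R y)"
      using assms unfolding is_norm_def by blast
    also have "\<dots> = \<bar>1 - t\<bar> * N x + \<bar>t\<bar> * N y"
      using assms unfolding is_norm_def by metis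
    finally show "N ((1 - t) *\<^sub>R x + t *\<^sub>R y) \<le> (1 - t) * N x + t * N y"
      using \<open>0 < t\<close> \<open>t < 1\<close> by simp
  qed simp
qed simp

text \<open>By continuity of \<open>N\<close> the ball is closed, so its frontier stays inside it,
  and the strict sublevel set is open, hence interior to the ball and disjoint from the
  frontier.\<close>

lemma mcircle_norm_eq:
  assumes "is_norm N" and "Y \<in> mcircle N M r"
  shows "N (Y - M) = r"
proof -
  have cont: "continuous_on UNIV (\<lambda>Z. N (Z - M))"
    by (rule continuous_on_compose2[OF is_norm_continuous_on[OF assms(1)]])
      (auto intro!: continuous_intros)
  have "closed (mball N M r)"
    unfolding mball_def by (intro closed_Collect_le cont continuous_on_const)
  then have "N (Y - M) \<le> r"
    using assms(2) frontier_subset_closed unfolding mcircle_def mball_def by blast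
  moreover have "open {Z. N (Z - M) < r}"
    by (intro open_Collect_less cont continuous_on_const)
  then have "{Z. N (Z - M) < r} \<subseteq> interior (mball N M r)"
    by (intro interior_maximal) (auto simp: mball_def)
  then have "\<not> N (Y - M) < r"
    using assms(2) by (auto simp: mcircle_def frontier_def)
  ultimately show ?thesis by linarith
qed

text \<open>\<open>Q\<close> is a convex combination of \<open>P\<close> and the new point, with
  weight \<open>1/t\<close> on the latter. Scaling by \<open>t\<close> avoids the division: the
  triangle inequality bounds \<open>t * r\<close> by the new distance plus
  \<open>(t - 1) * r\<close>.\<close>

lemma norm_ge_beyond_chord:
  assumes N: "is_norm N"
    and P: "N (P - M) = r" and Q: "N (Q - M) = r" and t: "t \<ge> 1"
  shows "N (P + t *\<^sub>R (Q - P) - M) \<ge> r"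
proof -
  let ?X = "P + t *\<^sub>R (Q - P)"
  have "t *\<^sub>R (Q - M) = (?X - M) + (t - 1) *\<^sub>R (P - M)"
    by (simp add: algebra_simps)
  then have "N (t *\<^sub>R (Q - M)) \<le> N (?X - M) + N ((t - 1) *\<^sub>R (P - M))"
    using N unfolding is_norm_def by metis
  moreover have "N (t *\<^sub>R (Q - M)) = t * r" "N ((t - 1) *\<^sub>R (P - M)) = (t - 1) * r"
    using N P Q t unfolding is_norm_def by auto
  ultimately show ?thesis by (simp add: algebra_simps)
qed

theorem theorem2p2:
  fixes N :: "real^2 \<Rightarrow> real" and A P Q M :: "real^2" and r :: real
    and F B :: "(real^2) set"
  assumes norm: "is_norm N"
    and triangle: "\<not> collinear {A, P, Q}"
    and circum: "is_circumcircle N A P Q M r"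
    and ball: "B = mball N M r"
    and side: "F = closed_segment P Q"
    and M_in_cone: "M \<in> cone_from ((affine hull F \<inter> B) - F) A"
  shows "M \<in> medial_line A F"
proof -
  have r: "r > 0" and A: "N (A - M) = r" and P: "N (P - M) = r" and Q: "N (Q - M) = r"
    using circum mcircle_norm_eq[OF norm] unfolding is_circumcircle_def by auto
  obtain l X where M: "M = A + l *\<^sub>R (X - A)"
    and X: "X \<in> affine hull F" "X \<in> B" "X \<notin> F"
    using M_in_cone unfolding cone_from_def by blast
  have "affine hull F = affine hull {P, Q}"
    unfolding side by (simp add: segment_convex_hull affine_hull_convex_hull)
  then obtain t where t: "X = P + t *\<^sub>R (Q - P)"
    using X(1) by (auto simp: affine_hull_2_alt)
  have "N (X - M) \<ge> r"
  proof (cases "t \<ge> 1")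
    case True
    then show ?thesis using norm_ge_beyond_chord[OF norm P Q] t by simp
  next
    case False
    have "X = (1 - t) *\<^sub>R P + t *\<^sub>R Q"
      using t by (simp add: algebra_simps)
    \<comment> \<open>Parameters in [0, 1] would put \<open>X\<close> on the side \<open>F\<close>.
      For negative \<open>t\<close>, exchanging \<open>P\<close> and \<open>Q\<close> turns the
      parameter into \<open>1 - t\<close>, which exceeds 1.\<close>
    then have "t < 0"
      using False X(3) unfolding side in_segment by (metis linorder_not_le order_less_imp_le)
    moreover have "X = Q + (1 - t) *\<^sub>R (P - Q)"
      using t by (simp add: algebra_simps)
    ultimately show ?thesis using norm_ge_beyond_chord[OF norm Q P, of "1 - t"] by simp
  qed
  then have XM: "N (X - M) = r"
    using X(2) unfolding ball mball_def by simp
  have "A - M = (- l) *\<^sub>R (X - A)" "X - M = (1 - l) *\<^sub>R (X - A)"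
    using M by (simp_all add: algebra_simps)
  then have "\<bar>l\<bar> * N (X - A) = r" "\<bar>1 - l\<bar> * N (X - A) = r"
    using A XM norm unfolding is_norm_def by (metis abs_minus_cancel)+
  \<comment> \<open>Since \<open>r\<close> is positive, the common factor \<open>N (X - A)\<close>
    is nonzero and cancels.\<close>
  then have "\<bar>l\<bar> = \<bar>1 - l\<bar>"
    using r by (metis mult_cancel_right mult_zero_right less_irrefl)
  then have l: "l = 1/2" by linarith
  have "M = (1/2) *\<^sub>R (A + X)"
    unfolding M l by (simp add: vec_eq_iff field_simps)
  then show ?thesis
    using X(1) unfolding medial_line_def by blast
qed

end
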